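(* Let $n\ge2$, let $M\in\mathbb{R}^{n\times n}$ be symmetric positive definite and $\hat\delta\in(0,1)$. Let $\{v_k\}_{k\ge1}$ be a sequence generated by the projected subgradient method described in the context, with stepsizes $t_k=1/\sqrt{k}$, and let $\kappa_*=\min_{v\in\hat\Omega}\kappa(v)$. Then for every tolerance $\epsilon>0$, $$\min_{1\le k\le K}\kappa(v_k)-\kappa_*\le\epsilon$$ holds for $K=\mathcal{O}(1/\epsilon^2)$; that is, there is a constant $C>0$ independent of $\epsilon$ such that the inequality holds for every $\epsilon>0$ and every integer $K\ge \max\{1,C/\epsilon^2\}$.
   Context: $e_m\in\mathbb{R}^m$ is the all-ones vector, $\bullet$ the Hadamard product, $\operatorname{Diag}(w)$ the diagonal matrix with diagonal $w$. Let $$V=\frac1{\sqrt2}\begin{bmatrix}I_{n-1}\\ -e_{n-1}^T\end{bmatrix}\in\mathbb{R}^{n\times(n-1)},\qquad \hat\Omega=\{v\in\mathbb{R}^{n-1}: e_n+Vv\ge\hat\delta e_n\},$$ equivalently $\hat\Omega=\{v:\sum_{i=1}^{n-1}v_i\le-\sqrt2(\hat\delta-1),\ v_i\ge\sqrt2(\hat\delta-1),\ i=1,\dots,n-1\}$. For $v\in\hat\Omega$ the matrix $M\operatorname{Diag}(e_n+Vv)$ has real positive eigenvalues, and $$\kappa(v):=\frac{\lambda_{\max}(M\operatorname{Diag}(e_n+Vv))}{\lambda_{\min}(M\operatorname{Diag}(e_n+Vv))}.$$ Projected subgradient method: $v_1=0\in\mathbb{R}^{n-1}$, $w_1=e_n$.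 For $k=1,2,\dots$: let $(\lambda_1^k,x_1^k)$ and $(\lambda_n^k,x_n^k)$ be any eigenpairs of $M\operatorname{Diag}(w_k)$ for its largest and smallest eigenvalue, respectively; set $$g_k=\frac{\lambda_1^k}{\lambda_n^k}V^T\left(\frac{x_1^k\bullet x_1^k}{\langle x_1^k,w_k\bullet x_1^k\rangle}-\frac{x_n^k\bullet x_n^k}{\langle x_n^k,w_k\bullet x_n^k\rangle}\right),\quad v_{k+1}=\Pi_{\hat\Omega}\left(v_k-t_k\frac{g_k}{\|g_k\|}\right),\quad w_{k+1}=e_n+Vv_{k+1},$$ where $\Pi_{\hat\Omega}$ is the Euclidean projection onto $\hat\Omega$. The method is run without stopping, and it is assumed that $g_k\ne0$ for all $k$, so that an infinite sequence is generated. *)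

theory Defs
  imports "HOL-Analysis.Analysis"
begin

text \<open>
  Dimension \<open>n \<ge> 2\<close>: coordinates of \<open>n - 1\<close> dimensional space are indexed by a finite type
  \<open>'m\<close> with \<open>n - 1\<close> elements, those of \<open>n\<close> dimensional space by \<open>'m option\<close>, where
  \<open>None\<close> is the last index. Since types are nonempty, \<open>n = CARD('m) + 1 \<ge> 2\<close>.

  On vectors, the library's \<open>1\<close> is the all-ones vector, \<open>x * y\<close> is the Hadamard product, and
  \<open>\<le>\<close> is the componentwise order.
\<close>

definition symmetric_positive_definite :: "real ^ 'n ^ 'n \<Rightarrow> bool" where
  "symmetric_positive_definite M \<longleftrightarrow>
     transpose M = M \<and> (\<forall>x. x \<noteq> 0 \<longrightarrow> 0 < x \<bullet> (M *v x))"

definition Diag :: "real ^ 'n \<Rightarrow> real ^ 'n ^ 'n" where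
  "Diag w = (\<chi> i j. if i = j then w $ i else 0)"

definition eigenpair :: "real ^ 'n ^ 'n \<Rightarrow> real \<Rightarrow> real ^ 'n \<Rightarrow> bool" where
  "eigenpair A l x \<longleftrightarrow> x \<noteq> 0 \<and> A *v x = l *\<^sub>R x"

text \<open>
  Only real eigenvalues are collected. The matrices to which this is applied are products of a
  symmetric positive definite matrix and a positive diagonal matrix; all their (complex)
  eigenvalues are real and positive, so the set below is then nonempty, and it is always finite.
\<close>

definition eigenvalues :: "real ^ 'n ^ 'n \<Rightarrow> real set" where
  "eigenvalues A = {l. \<exists>x. eigenpair A l x}"

definition lambda_max :: "real ^ 'n ^ 'n \<Rightarrow> real" where
  "lambda_max A = Max (eigenvalues A)"

definition lambda_min :: "real ^ 'n ^ 'n \<Rightarrow> real" where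
  "lambda_min A = Min (eigenvalues A)"

definition V :: "real ^ 'm ^ 'm option" where
  "V = (1 / sqrt 2) *\<^sub>R
     (\<chi> i j. case i of Some i' \<Rightarrow> (if i' = j then 1 else 0) | None \<Rightarrow> - 1)"

definition weight :: "real ^ 'm \<Rightarrow> real ^ 'm option" where
  "weight v = 1 + V *v v"

definition Omega :: "real \<Rightarrow> (real ^ 'm) set" where
  "Omega \<delta> = {v. \<delta> *\<^sub>R 1 \<le> weight v}"

definition kappa :: "real ^ 'm option ^ 'm option \<Rightarrow> real ^ 'm \<Rightarrow> real" where
  "kappa M v = lambda_max (M ** Diag (weight v)) / lambda_min (M ** Diag (weight v))"

definition direction ::
  "real ^ 'm option \<Rightarrow> real \<Rightarrow> real ^ 'm option \<Rightarrow> real \<Rightarrow> real ^ 'm option \<Rightarrow> real ^ 'm" where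
  "direction w lmax xmax lmin xmin =
     (lmax / lmin) *\<^sub>R (transpose V *v
       ((xmax * xmax) /\<^sub>R (xmax \<bullet> (w * xmax)) - (xmin * xmin) /\<^sub>R (xmin \<bullet> (w * xmin))))"

text \<open>
  The eigenvectors are chosen freely in each iteration, independently of other iterations.
  Iterates are numbered from 1; \<open>t 0\<close>, \<open>v 0\<close> and \<open>g 0\<close> are irrelevant.
\<close>

definition projected_subgradient_run ::
  "real ^ 'm option ^ 'm option \<Rightarrow> real \<Rightarrow> (nat \<Rightarrow> real) \<Rightarrow>
     (nat \<Rightarrow> real ^ 'm) \<Rightarrow> (nat \<Rightarrow> real ^ 'm) \<Rightarrow> bool" where
  "projected_subgradient_run M \<delta> t v g \<longleftrightarrow>
     v 1 = 0 \<and>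
     (\<forall>k\<ge>1.
        (\<exists>lmax xmax lmin xmin.
           lmax = lambda_max (M ** Diag (weight (v k))) \<and>
           eigenpair (M ** Diag (weight (v k))) lmax xmax \<and>
           lmin = lambda_min (M ** Diag (weight (v k))) \<and>
           eigenpair (M ** Diag (weight (v k))) lmin xmin \<and>
           g k = direction (weight (v k)) lmax xmax lmin xmin) \<and>
        v (Suc k) = closest_point (Omega \<delta>) (v k - t k *\<^sub>R (g k /\<^sub>R norm (g k))))"

end

theory Submission
  imports Defs
begin

text \<open>
  Let \<open>p\<close> and \<open>q\<close> be the normalised squares of the extreme eigenvectors at \<open>v\<close>, and let \<open>u\<close> have
  weights \<open>w\<close>. Substituting \<open>x = M y\<close> turns the eigenvalues of \<open>M Diag(w)\<close> into those of a
  symmetric pencil, whose extreme eigenvalues are a maximum and a minimum of functions linear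
  in \<open>w\<close>. Hence \<open>\<kappa>(v) (p \<bullet> w) \<le> \<kappa>(u) (q \<bullet> w)\<close>, which says that
  \<open>(q \<bullet> w) (\<kappa>(v) - \<kappa>(u)) \<le> g \<bullet> (v - u)\<close>, where \<open>g\<close> is the direction of the method.
  On \<open>Omega\<close> the factor \<open>q \<bullet> w\<close> is bounded below and \<open>g\<close> is bounded. So \<open>\<kappa>\<close> is Lipschitz and attains
  its minimum on this compact set, and as long as the gap exceeds \<open>\<epsilon>\<close>, the squared distance
  to a minimiser changes by at most \<open>- 2 c \<epsilon> / sqrt k + 1 / k\<close>. Adding this up for
  \<open>K / 2 < k \<le> K\<close> bounds \<open>\<epsilon> sqrt K\<close>.
\<close>

section \<open>Semidefinite forms and symmetric pencils\<close>

text \<open>A nonnegative form is minimal where it vanishes; a short step from \<open>y\<close>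
  against \<open>Q *v y\<close> would make it negative unless that vector is zero.\<close>

lemma psd_null_vector:
  fixes Q :: "real ^ 'n ^ 'n"
  assumes sym: "transpose Q = Q" and psd: "\<And>z. 0 \<le> z \<bullet> (Q *v z)" and null: "y \<bullet> (Q *v y) = 0"
  shows "Q *v y = 0"
proof -
  define z where "z = Q *v y"
  define c where "c = z \<bullet> (Q *v z)"
  define s where "s = z \<bullet> z"
  have c0: "c \<ge> 0" unfolding c_def by (rule psd)
  \<comment> \<open>Along \<open>y + t *\<^sub>R z\<close> the form is
    \<open>2 * t * s + t\<^sup>2 * c\<close>; the summand 1 keeps the denominator positive even if
    \<open>c = 0\<close>.\<close>
  define t where "t = - s / (c + 1)"
  have yz: "y \<bullet> (Q *v z) = s"
    by (metis s_def z_def dot_lmul_matrix vector_transpose_matrix sym inner_commute)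
  have "0 \<le> (y + t *\<^sub>R z) \<bullet> (Q *v (y + t *\<^sub>R z))" by (rule psd)
  also have "\<dots> = 2 * t * s + t\<^sup>2 * c"
    using yz null
    by (simp add: matrix_vector_right_distrib matrix_vector_mult_scaleR inner_add_left inner_add_right
        c_def s_def z_def[symmetric] power2_eq_square algebra_simps)
  also have "s = - t * (c + 1)" using c0 by (simp add: t_def)
  finally have "t\<^sup>2 * (c + 2) \<le> 0" by (simp add: power2_eq_square algebra_simps)
  then have "t = 0" using c0 by (simp add: mult_le_0_iff)
  then have "s = 0" using c0 by (simp add: t_def)
  then show ?thesis by (simp add: s_def z_def)
qed

text \<open>If \<open>y\<close> maximises the quotient of the two forms on the unit sphere, with
  value \<open>l\<close>, then \<open>l *\<^sub>R B - A\<close> is positive semidefinite with zero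
  form at \<open>y\<close>, so \<open>psd_null_vector\<close> yields the eigenvector equation
  without differentiation.\<close>

lemma pencil_max_eigenvalue:
  fixes A B :: "real ^ 'n ^ 'n"
  assumes symA: "transpose A = A" and B: "symmetric_positive_definite B"
  obtains l y where "y \<noteq> 0" "A *v y = l *\<^sub>R (B *v y)" "\<And>z. z \<bullet> (A *v z) \<le> l * (z \<bullet> (B *v z))"
proof -
  let ?S = "sphere (0::real^'n) 1"
  let ?f = "\<lambda>y. (y \<bullet> (A *v y)) / (y \<bullet> (B *v y))"
  have posB: "0 < z \<bullet> (B *v z)" if "z \<noteq> 0" for z
    using B that by (simp add: symmetric_positive_definite_def)
  have "continuous_on ?S ?f"
    by (intro continuous_intros linear_continuous_on matrix_vector_mul_bounded_linear)
      (metis posB less_irrefl mem_sphere_0 norm_zero zero_neq_one)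
  then obtain y where y: "y \<in> ?S" "\<And>z. z \<in> ?S \<Longrightarrow> ?f z \<le> ?f y"
    using continuous_attains_sup[of ?S ?f] by auto
  define l where "l = ?f y"
  have y0: "y \<noteq> 0" using y by auto
  have le: "z \<bullet> (A *v z) \<le> l * (z \<bullet> (B *v z))" for z
  proof (cases "z = 0")
    case False
    let ?u = "z /\<^sub>R norm z"
    have "?f ?u \<le> l" using False y(2)[of ?u] by (simp add: l_def)
    moreover have "?f ?u = ?f z" using False by (simp add: matrix_vector_mult_scaleR)
    ultimately show ?thesis using posB[OF False] by (simp add: pos_divide_le_eq)
  qed simp
  let ?Q = "l *\<^sub>R B - A"
  have Qv: "?Q *v z = l *\<^sub>R (B *v z) - A *v z" for z
    by (simp add: matrix_vector_mult_diff_rdistrib scaleR_matrix_vector_assoc)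
  have "?Q *v y = 0"
  proof (rule psd_null_vector)
    show "transpose ?Q = ?Q"
      using symA B by (simp add: symmetric_positive_definite_def transpose_def vec_eq_iff)
    show "0 \<le> z \<bullet> (?Q *v z)" for z using le[of z] by (simp add: Qv inner_diff_right)
    show "y \<bullet> (?Q *v y) = 0" using posB[OF y0] unfolding Qv inner_diff_right by (simp add: l_def)
  qed
  then show ?thesis using that[OF y0 _ le] by (simp add: Qv)
qed

section \<open>Spectrum of a positive definite matrix times a positive diagonal matrix\<close>

lemma Diag_vector_mult: "Diag w *v x = w * (x :: real ^ 'n)"
proof -
  have "(\<Sum>j\<in>UNIV. (if i = j then w $ i else 0) * x $ j) = w $ i * x $ i" for i
    by (simp add: if_distrib[of "\<lambda>a. a * _"] cong: if_cong)
  then show ?thesis by (simp add: Diag_def matrix_vector_mult_def vec_eq_iff)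
qed

lemma inner_hadamard_commute: "x \<bullet> (w * y) = (w * x) \<bullet> (y :: real ^ 'n)"
  by (simp add: inner_vec_def mult_ac)

lemma inner_hadamard_pos:
  fixes w x :: "real ^ 'n"
  assumes "\<And>i. 0 < w $ i" "x \<noteq> 0"
  shows "0 < x \<bullet> (w * x)"
proof -
  obtain i where "x $ i \<noteq> 0" using assms(2) by (auto simp: vec_eq_iff)
  moreover have "x \<bullet> (w * x) = (\<Sum>i\<in>UNIV. w $ i * (x $ i)\<^sup>2)"
    by (simp add: inner_vec_def power2_eq_square mult_ac)
  ultimately show ?thesis
    using assms(1) by (auto intro!: sum_pos2[of _ i] mult_nonneg_nonneg simp: less_imp_le)
qed

locale weighted_spd =
  fixes M :: "real ^ 'n ^ 'n" and w :: "real ^ 'n"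
  assumes spd: "symmetric_positive_definite M" and pos: "\<And>i. 0 < w $ i"
begin

abbreviation "MW \<equiv> M ** Diag w"

lemma MW_mult: "MW *v x = M *v (w * x)"
  by (simp add: matrix_vector_mul_assoc[symmetric] Diag_vector_mult)

lemma M_self_adjoint: "x \<bullet> (M *v y) = (M *v x) \<bullet> y"
  using spd by (metis symmetric_positive_definite_def dot_lmul_matrix vector_transpose_matrix inner_commute)

text \<open>Pairing the eigenvector equation with \<open>w * x\<close> equates a positive value of
  the form of \<open>M\<close> with \<open>l\<close> times a positive number.\<close>

lemma eigenvalue_pos:
  assumes "eigenpair MW l x"
  shows "0 < l"
proof -
  have x: "x \<noteq> 0" "M *v (w * x) = l *\<^sub>R x" using assms by (auto simp: eigenpair_def MW_mult)
  have "w * x \<noteq> 0" using x(1) pos by (auto simp: vec_eq_iff less_imp_neq[symmetric])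
  then have "0 < (w * x) \<bullet> (M *v (w * x))"
    using spd by (simp add: symmetric_positive_definite_def)
  also have "\<dots> = l * (x \<bullet> (w * x))" by (simp add: x(2) inner_commute)
  finally show ?thesis using inner_hadamard_pos[OF pos x(1)] by (simp add: zero_less_mult_iff)
qed

text \<open>Eigenvectors for distinct eigenvalues are orthogonal in the inner product weighted by
  \<open>w\<close>. Scaling coordinates by the roots of the weights makes this ordinary
  orthogonality, hence independence. Finiteness is what makes \<open>Max\<close> and
  \<open>Min\<close> meaningful.\<close>

lemma finite_eigenvalues: "finite (eigenvalues MW)"
proof -
  have "\<forall>l\<in>eigenvalues MW. \<exists>x. eigenpair MW l x" by (simp add: eigenvalues_def)
  from bchoice[OF this] obtain X where X: "\<And>l. l \<in> eigenvalues MW \<Longrightarrow> eigenpair MW l (X l)"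
    by blast
  define Y where "Y l = (\<chi> i. sqrt (w $ i) * X l $ i)" for l
  have Y: "Y k \<bullet> Y l = X k \<bullet> (w * X l)" for k l
    unfolding inner_vec_def Y_def using pos by (intro sum.cong) (auto simp: mult_ac less_imp_le)
  have orth: "Y k \<bullet> Y l = 0" if "k \<in> eigenvalues MW" "l \<in> eigenvalues MW" "k \<noteq> l" for k l
  proof -
    have e: "M *v (w * X k) = k *\<^sub>R X k" "M *v (w * X l) = l *\<^sub>R X l"
      using X that(1,2) by (auto simp: eigenpair_def MW_mult)
    have "(w * X k) \<bullet> (M *v (w * X l)) = l * (X k \<bullet> (w * X l))"
      by (simp add: e inner_hadamard_commute)
    moreover have "(w * X k) \<bullet> (M *v (w * X l)) = k * (X k \<bullet> (w * X l))"
      by (subst M_self_adjoint) (simp add: e)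
    ultimately show ?thesis using that(3) Y by auto
  qed
  have nz: "Y l \<noteq> 0" if "l \<in> eigenvalues MW" for l
    using inner_hadamard_pos[OF pos, of "X l"] X[OF that] Y[of l l] by (auto simp: eigenpair_def)
  have "inj_on Y (eigenvalues MW)"
    using orth nz by (metis inj_onI inner_eq_zero_iff)
  moreover have "finite (Y ` eigenvalues MW)"
    using orth nz
    by (intro independent_imp_finite pairwise_orthogonal_independent)
      (auto simp: pairwise_def orthogonal_def)
  ultimately show ?thesis using finite_imageD by blast
qed

text \<open>The substitution \<open>x = M *v y\<close> carries solutions of the symmetric pencil
  \<open>MW ** M\<close>, \<open>M\<close> to eigenvectors of \<open>MW\<close>.\<close>

lemma eigenpairI:
  assumes "y \<noteq> 0" "((M ** Diag w) ** M) *v y = l *\<^sub>R (M *v y)"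
  shows "eigenpair MW l (M *v y)"
proof -
  have "y \<bullet> (M *v y) > 0" using spd assms(1) by (simp add: symmetric_positive_definite_def)
  then show ?thesis using assms(2) by (auto simp: eigenpair_def matrix_vector_mul_assoc)
qed

lemma MWM_quadratic_form: "y \<bullet> ((MW ** M) *v y) = (M *v y) \<bullet> (w * (M *v y))"
  by (simp add: matrix_vector_mul_assoc[symmetric] Diag_vector_mult M_self_adjoint)

lemma MWM_symmetric: "transpose (MW ** M) = MW ** M"
proof -
  have "transpose (Diag w) = Diag w" by (auto simp: transpose_def Diag_def vec_eq_iff)
  then show ?thesis
    using spd by (simp add: symmetric_positive_definite_def matrix_transpose_mul matrix_mul_assoc)
qed

lemma quadratic_form_nonneg: "0 \<le> y \<bullet> (M *v y)"
  using spd by (cases "y = 0") (auto simp: symmetric_positive_definite_def less_imp_le)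

text \<open>The largest pencil eigenvalue bounds every quotient and is itself an eigenvalue of
  \<open>MW\<close>, so it is at most \<open>lambda_max MW\<close>.\<close>

lemma rayleigh_max: "(M *v y) \<bullet> (w * (M *v y)) \<le> lambda_max MW * (y \<bullet> (M *v y))"
proof -
  obtain l z where z: "z \<noteq> 0" "(MW ** M) *v z = l *\<^sub>R (M *v z)"
    and le: "\<And>y. y \<bullet> ((MW ** M) *v y) \<le> l * (y \<bullet> (M *v y))"
    using pencil_max_eigenvalue[OF MWM_symmetric spd] by metis
  have "l \<in> eigenvalues MW" using eigenpairI[OF z] by (auto simp: eigenvalues_def)
  then have "l \<le> lambda_max MW" by (simp add: lambda_max_def finite_eigenvalues)
  then show ?thesis
    using le[of y] quadratic_form_nonneg[of y] unfolding MWM_quadratic_form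
    by (meson mult_right_mono order_trans)
qed

text \<open>Obtained from the maximum for the negated pencil. The eigenvalue found this way also
  shows that the spectrum is nonempty, so that \<open>Min\<close> and \<open>Max\<close> are
  attained.\<close>

lemma lambda_min_eigenvalue: "lambda_min MW \<in> eigenvalues MW"
  and rayleigh_min: "lambda_min MW * (y \<bullet> (M *v y)) \<le> (M *v y) \<bullet> (w * (M *v y))"
proof -
  have neg: "(- (MW ** M)) *v z = - ((MW ** M) *v z)" for z
    using matrix_vector_mult_diff_rdistrib[of 0 "MW ** M" z] by simp
  have "transpose (- (MW ** M)) = - (MW ** M)"
    using MWM_symmetric by (simp add: transpose_def vec_eq_iff)
  then obtain l z where z: "z \<noteq> 0" "(- (MW ** M)) *v z = l *\<^sub>R (M *v z)"
    and le: "\<And>y. y \<bullet> ((- (MW ** M)) *v y) \<le> l * (y \<bullet> (M *v y))"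
    using pencil_max_eigenvalue[OF _ spd] by metis
  have "(MW ** M) *v z = (- l) *\<^sub>R (M *v z)" using z(2) neg by (simp add: minus_equation_iff)
  then have l: "- l \<in> eigenvalues MW"
    using eigenpairI[OF z(1)] unfolding eigenvalues_def by blast
  then show "lambda_min MW \<in> eigenvalues MW"
    unfolding lambda_min_def using finite_eigenvalues by (auto intro!: Min_in)
  have "lambda_min MW \<le> - l" using l by (simp add: lambda_min_def finite_eigenvalues)
  then have "lambda_min MW * (y \<bullet> (M *v y)) \<le> - l * (y \<bullet> (M *v y))"
    using quadratic_form_nonneg by (intro mult_right_mono)
  also have "\<dots> \<le> (M *v y) \<bullet> (w * (M *v y))"
    using le[of y] unfolding neg inner_minus_right MWM_quadratic_form by simp
  finally show "lambda_min MW * (y \<bullet> (M *v y)) \<le> (M *v y) \<bullet> (w * (M *v y))" .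
qed

lemma lambda_min_pos: "0 < lambda_min MW"
  using lambda_min_eigenvalue eigenvalue_pos by (auto simp: eigenvalues_def)

lemma lambda_max_eigenvalue: "lambda_max MW \<in> eigenvalues MW"
  unfolding lambda_max_def using finite_eigenvalues lambda_min_eigenvalue by (auto intro!: Max_in)

text \<open>Writes an eigenvector as \<open>M *v y\<close> with Rayleigh quotient \<open>l\<close>
  at \<open>y\<close>, so that it can be tested in the quotients for other weights.\<close>

lemma eigenpair_preimage:
  assumes "eigenpair MW l x"
  obtains y where "M *v y = x" "l * (y \<bullet> (M *v y)) = x \<bullet> (w * x)"
proof
  let ?y = "(w * x) /\<^sub>R l"
  have l: "l > 0" using assms by (rule eigenvalue_pos)
  show *: "M *v ?y = x"
    using assms l by (simp add: eigenpair_def MW_mult matrix_vector_mult_scaleR)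
  show "l * (?y \<bullet> (M *v ?y)) = x \<bullet> (w * x)"
    unfolding * using l by (simp add: inner_commute)
qed

end

section \<open>Comparing condition numbers at two weight vectors\<close>

text \<open>If \<open>x\<close> belongs to a simple eigenvalue of \<open>M ** Diag w\<close>, this
  is the gradient of the logarithm of that eigenvalue with respect to the weights.\<close>

definition normalized_square :: "real ^ 'n \<Rightarrow> real ^ 'n \<Rightarrow> real ^ 'n" where
  "normalized_square w x = (x * x) /\<^sub>R (x \<bullet> (w * x))"

lemma inner_normalized_square:
  "normalized_square w x \<bullet> u = (x \<bullet> (u * x)) / (x \<bullet> (w * x))"
  by (simp add: normalized_square_def inner_vec_def divide_inverse mult_ac sum_distrib_right)

text \<open>
  Both eigenvalues are optimal values of Rayleigh quotients over a set independent of the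
  weights, with numerators linear in the weights. Testing them at \<open>u\<close> with the eigenvectors
  belonging to \<open>w\<close> gives the two inequalities below.
\<close>

lemma lambda_max_subgradient:
  assumes "weighted_spd M w" "weighted_spd M u" "eigenpair (M ** Diag w) l x"
  shows "l * (normalized_square w x \<bullet> u) \<le> lambda_max (M ** Diag u)"
proof -
  interpret w: weighted_spd M w by fact
  interpret u: weighted_spd M u by fact
  obtain y where y: "M *v y = x" "l * (y \<bullet> (M *v y)) = x \<bullet> (w * x)"
    using w.eigenpair_preimage[OF assms(3)] .
  have l: "0 < l" using w.eigenvalue_pos[OF assms(3)] .
  have p: "0 < x \<bullet> (w * x)"
    using inner_hadamard_pos[OF w.pos] assms(3) by (simp add: eigenpair_def)
  have "x \<bullet> (u * x) * l \<le> lambda_max (M ** Diag u) * (x \<bullet> (w * x))"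
    using mult_left_mono[OF u.rayleigh_max[of y] less_imp_le[OF l]] unfolding y(2)[symmetric] y(1)
    by (simp add: mult_ac)
  then show ?thesis using p by (simp add: inner_normalized_square field_simps)
qed

lemma lambda_min_supergradient:
  assumes "weighted_spd M w" "weighted_spd M u" "eigenpair (M ** Diag w) l x"
  shows "lambda_min (M ** Diag u) \<le> l * (normalized_square w x \<bullet> u)"
proof -
  interpret w: weighted_spd M w by fact
  interpret u: weighted_spd M u by fact
  obtain y where y: "M *v y = x" "l * (y \<bullet> (M *v y)) = x \<bullet> (w * x)"
    using w.eigenpair_preimage[OF assms(3)] .
  have l: "0 < l" using w.eigenvalue_pos[OF assms(3)] .
  have p: "0 < x \<bullet> (w * x)"
    using inner_hadamard_pos[OF w.pos] assms(3) by (simp add: eigenpair_def)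
  have "lambda_min (M ** Diag u) * (x \<bullet> (w * x)) \<le> x \<bullet> (u * x) * l"
    using mult_left_mono[OF u.rayleigh_min[of y] less_imp_le[OF l]] unfolding y(2)[symmetric] y(1)
    by (simp add: mult_ac)
  then show ?thesis using p by (simp add: inner_normalized_square field_simps)
qed

text \<open>The bounds for the two extreme eigenvalues at \<open>u\<close>, each multiplied by the
  other eigenvalue, chain through their product.\<close>

lemma condition_number_ratio:
  assumes w: "weighted_spd M w" and u: "weighted_spd M u"
    and "eigenpair (M ** Diag w) l x" and e: "eigenpair (M ** Diag w) l' x'"
  shows "l / l' * (normalized_square w x \<bullet> u)
    \<le> lambda_max (M ** Diag u) / lambda_min (M ** Diag u) * (normalized_square w x' \<bullet> u)"
proof -
  interpret w: weighted_spd M w by fact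
  interpret u: weighted_spd M u by fact
  let ?p = "normalized_square w x \<bullet> u" and ?q = "normalized_square w x' \<bullet> u"
  let ?a = "lambda_max (M ** Diag u)" and ?b = "lambda_min (M ** Diag u)"
  have l': "0 < l'" using w.eigenvalue_pos[OF e] .
  have a: "0 < ?a" using u.lambda_max_eigenvalue u.eigenvalue_pos by (auto simp: eigenvalues_def)
  have "l * ?p * ?b \<le> ?a * ?b"
    using lambda_max_subgradient[OF assms(1-3)] u.lambda_min_pos by simp
  also have "\<dots> \<le> ?a * (l' * ?q)"
    using lambda_min_supergradient[OF w u e] a by simp
  finally show ?thesis using l' u.lambda_min_pos by (simp add: field_simps)
qed

lemma inner_normalized_square_self:
  assumes "weighted_spd M w" "x \<noteq> 0"
  shows "normalized_square w x \<bullet> w = 1"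
proof -
  interpret weighted_spd M w by fact
  show ?thesis
    using inner_hadamard_pos[OF pos assms(2)] by (simp add: inner_normalized_square)
qed

lemma normalized_square_nonneg:
  assumes "weighted_spd M w"
  shows "0 \<le> normalized_square w x $ i"
proof (cases "x = 0")
  case False
  interpret weighted_spd M w by fact
  show ?thesis
    using inner_hadamard_pos[OF pos False] by (simp add: normalized_square_def)
qed (simp add: normalized_square_def)

lemma inner_normalized_square_mono:
  assumes "weighted_spd M w" "\<And>i. u $ i \<le> u' $ i"
  shows "normalized_square w x \<bullet> u \<le> normalized_square w x \<bullet> u'"
  unfolding inner_vec_def
  using assms normalized_square_nonneg by (auto intro!: sum_mono mult_left_mono)

section \<open>The feasible set and its weights\<close>

lemma weight_nth:
  "weight v $ Some i = 1 + v $ i / sqrt 2"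
  "weight v $ None = 1 - (\<Sum>i\<in>UNIV. v $ i) / sqrt 2"
proof -
  have "(\<Sum>j\<in>UNIV. (if i = j then 1 else 0) * v $ j) = v $ i" for i
    by (simp add: if_distrib[of "\<lambda>a. a * _"] cong: if_cong)
  then show "weight v $ Some i = 1 + v $ i / sqrt 2"
    by (simp add: weight_def V_def matrix_vector_mult_def sum_divide_distrib[symmetric])
  show "weight v $ None = 1 - (\<Sum>i\<in>UNIV. v $ i) / sqrt 2"
    by (simp add: weight_def V_def matrix_vector_mult_def sum_negf sum_divide_distrib[symmetric])
qed

text \<open>The columns of \<open>V\<close> sum to zero, so the weights keep the sum of the all-ones
  vector. Together with nonnegativity this bounds each weight from above.\<close>

lemma sum_weight:
  "(\<Sum>i\<in>UNIV. weight (v :: real ^ 'm) $ i) = real CARD('m option)"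
proof -
  have "(\<Sum>i\<in>UNIV. weight v $ i) = weight v $ None + (\<Sum>i\<in>UNIV. weight v $ Some i)"
    unfolding UNIV_option_conv by (subst sum.insert) (auto simp: sum.reindex)
  then show ?thesis
    by (simp add: weight_nth sum.distrib sum_divide_distrib card_UNIV_option)
qed

lemma mem_Omega: "v \<in> Omega \<delta> \<longleftrightarrow> (\<forall>i. \<delta> \<le> weight v $ i)"
  by (simp add: Omega_def less_eq_vec_def)

lemma zero_in_Omega: "\<delta> \<le> 1 \<Longrightarrow> 0 \<in> Omega \<delta>"
  by (simp add: mem_Omega weight_def)

lemma weight_le_card:
  fixes v :: "real ^ 'm"
  assumes "v \<in> Omega \<delta>" "0 \<le> \<delta>"
  shows "weight v $ i \<le> real CARD('m option)"
proof -
  have "0 \<le> weight v $ j" for j using assms by (meson mem_Omega order_trans)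
  then have "weight v $ i \<le> (\<Sum>i\<in>UNIV. weight v $ i)" by (intro member_le_sum) auto
  then show ?thesis by (simp only: sum_weight)
qed

lemma convex_Omega: "convex (Omega \<delta>)"
proof (rule convexI)
  fix x y :: "real ^ 'm" and a b :: real
  assume *: "x \<in> Omega \<delta>" "y \<in> Omega \<delta>" "0 \<le> a" "0 \<le> b" "a + b = 1"
  have "weight (a *\<^sub>R x + b *\<^sub>R y) = (a + b) *\<^sub>R 1 + V *v (a *\<^sub>R x + b *\<^sub>R y)"
    by (simp add: weight_def *(5))
  also have "\<dots> = a *\<^sub>R weight x + b *\<^sub>R weight y"
    by (simp add: weight_def matrix_vector_right_distrib matrix_vector_mult_scaleR algebra_simps)
  finally have "weight (a *\<^sub>R x + b *\<^sub>R y) = a *\<^sub>R weight x + b *\<^sub>R weight y" .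
  moreover have "a * \<delta> + b * \<delta> \<le> a * weight x $ i + b * weight y $ i" for i
    using * by (intro add_mono mult_left_mono) (auto simp: mem_Omega)
  ultimately show "a *\<^sub>R x + b *\<^sub>R y \<in> Omega \<delta>"
    using *(5) by (simp add: mem_Omega distrib_right[symmetric])
qed

lemma closed_Omega: "closed (Omega \<delta> :: (real ^ 'm) set)"
proof -
  have "Omega \<delta> = {v :: real ^ 'm. \<forall>i. \<delta> \<le> weight v $ i}" by (auto simp: mem_Omega)
  then show ?thesis
    unfolding weight_def
    by (simp only:) (intro closed_Collect_all closed_Collect_le continuous_intros
        linear_continuous_on matrix_vector_mul_bounded_linear)
qed

lemma bounded_Omega:
  assumes "0 \<le> \<delta>"
  shows "bounded (Omega \<delta> :: (real ^ 'm) set)"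
proof (rule boundedI)
  let ?n = "real CARD('m option)"
  fix v :: "real ^ 'm" assume v: "v \<in> Omega \<delta>"
  have "\<bar>v $ i\<bar> \<le> ?n * sqrt 2" for i
  proof -
    have "v $ i / sqrt 2 \<le> ?n" "- ?n \<le> v $ i / sqrt 2"
      using weight_le_card[OF v assms, of "Some i"] v assms
      by (auto simp: mem_Omega weight_nth dest: spec[of _ "Some i"])
    then show ?thesis by (simp add: field_simps abs_le_iff)
  qed
  then have "(\<Sum>i\<in>UNIV. \<bar>v $ i\<bar>) \<le> (\<Sum>i\<in>(UNIV :: 'm set). ?n * sqrt 2)"
    by (intro sum_mono)
  then show "norm v \<le> (\<Sum>i\<in>(UNIV :: 'm set). ?n * sqrt 2)"
    using norm_le_l1_cart order_trans by blast
qed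

lemma compact_Omega: "0 \<le> \<delta> \<Longrightarrow> compact (Omega \<delta>)"
  by (simp add: compact_eq_bounded_closed closed_Omega bounded_Omega)

section \<open>Uniform estimates for \<open>kappa\<close> and its directions on
  \<open>Omega\<close>\<close>

locale kappa_setting =
  fixes M :: "real ^ ('m::finite) option ^ 'm option" and \<delta> n :: real
  assumes n_def: "n = real CARD('m option)" and spd: "symmetric_positive_definite M" and \<delta>: "0 < \<delta>" "\<delta> < 1"
begin

lemma n_pos: "0 < n"
  by (simp add: n_def)

abbreviation "MWt v \<equiv> M ** Diag (weight v)"

lemma weighted_spd_weight: "v \<in> Omega \<delta> \<Longrightarrow> weighted_spd M (weight v)"
  using spd \<delta> by unfold_locales (auto simp: mem_Omega intro: less_le_trans)

text \<open>All weights lie between \<delta> and \<open>n\<close>, so \<open>weight u\<close>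
  dominates \<delta> \<open>/ n\<close> times \<open>weight v\<close>, against which the normalised
  square has inner product 1.\<close>

lemma inner_normalized_square_lower:
  fixes v u :: "real ^ 'm"
  assumes "v \<in> Omega \<delta>" "u \<in> Omega \<delta>" "x \<noteq> 0"
  shows "\<delta> / n \<le> normalized_square (weight v) x \<bullet> weight u"
proof -
  have "\<delta> / n = normalized_square (weight v) x \<bullet> ((\<delta> / n) *\<^sub>R weight v)"
    using inner_normalized_square_self[OF weighted_spd_weight assms(3)] assms(1) by simp
  also have "\<dots> \<le> normalized_square (weight v) x \<bullet> weight u"
  proof (rule inner_normalized_square_mono[OF weighted_spd_weight[OF assms(1)]])
    fix i
    have "\<delta> * weight v $ i \<le> \<delta> * n"
      using weight_le_card[OF assms(1)] \<delta> unfolding n_def by (intro mult_left_mono) auto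
    moreover have "\<delta> * n \<le> weight u $ i * n"
      using assms(2) n_pos by (intro mult_right_mono) (auto simp: mem_Omega)
    ultimately have "\<delta> * weight v $ i \<le> weight u $ i * n" by linarith
    then show "((\<delta> / n) *\<^sub>R weight v) $ i \<le> weight u $ i"
      using n_pos by (simp add: pos_divide_le_eq)
  qed
  finally show ?thesis .
qed

text \<open>Since the entries of the normalised square are nonnegative, this bounds its sum
  norm.\<close>

lemma inner_normalized_square_one_le:
  fixes v :: "real ^ 'm"
  assumes "v \<in> Omega \<delta>" "x \<noteq> 0"
  shows "normalized_square (weight v) x \<bullet> 1 \<le> 1 / \<delta>"
proof -
  have "normalized_square (weight v) x \<bullet> 1 \<le> normalized_square (weight v) x \<bullet> ((1 / \<delta>) *\<^sub>R weight v)"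
    using assms(1) \<delta>
    by (intro inner_normalized_square_mono[OF weighted_spd_weight]) (auto simp: mem_Omega field_simps)
  also have "\<dots> = 1 / \<delta>"
    using inner_normalized_square_self[OF weighted_spd_weight assms(2)] assms(1) by simp
  finally show ?thesis .
qed

lemma norm_normalized_square_le:
  fixes v :: "real ^ 'm"
  assumes "v \<in> Omega \<delta>" "x \<noteq> 0"
  shows "norm (normalized_square (weight v) x) \<le> 1 / \<delta>"
proof -
  have "norm (normalized_square (weight v) x) \<le> (\<Sum>i\<in>UNIV. \<bar>normalized_square (weight v) x $ i\<bar>)"
    by (rule norm_le_l1_cart)
  also have "\<dots> = normalized_square (weight v) x \<bullet> 1"
    using normalized_square_nonneg[OF weighted_spd_weight[OF assms(1)]] by (simp add: inner_vec_def)
  finally show ?thesis using inner_normalized_square_one_le[OF assms] by simp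
qed

text \<open>A relation and not a choice function: extreme eigenvalues may be multiple, and the
  method may pick any eigenvectors.\<close>

definition max_min_pairs :: "real ^ 'm \<Rightarrow> real ^ 'm option \<Rightarrow> real ^ 'm option \<Rightarrow> bool" where
  "max_min_pairs v x y \<longleftrightarrow>
     eigenpair (MWt v) (lambda_max (MWt v)) x \<and> eigenpair (MWt v) (lambda_min (MWt v)) y"

definition subgrad :: "real ^ 'm \<Rightarrow> real ^ 'm option \<Rightarrow> real ^ 'm option \<Rightarrow> real ^ 'm" where
  "subgrad v x y = direction (weight v) (lambda_max (MWt v)) x (lambda_min (MWt v)) y"

lemma subgrad_eq:
  "subgrad v x y =
    kappa M v *\<^sub>R (transpose V *v (normalized_square (weight v) x - normalized_square (weight v) y))"
  by (simp add: subgrad_def direction_def kappa_def normalized_square_def)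

lemma max_min_pairs_exist:
  assumes "v \<in> Omega \<delta>"
  obtains x y where "max_min_pairs v x y"
proof -
  interpret weighted_spd M "weight v" using assms by (rule weighted_spd_weight)
  show ?thesis
    using that lambda_max_eigenvalue lambda_min_eigenvalue
    by (auto simp: max_min_pairs_def eigenvalues_def)
qed

lemma max_min_pairs_nonzero:
  assumes "max_min_pairs v x y"
  shows "x \<noteq> 0" "y \<noteq> 0"
  using assms by (auto simp: max_min_pairs_def eigenpair_def)

lemma kappa_pos:
  assumes "v \<in> Omega \<delta>"
  shows "0 < kappa M v"
proof -
  interpret weighted_spd M "weight v" using assms by (rule weighted_spd_weight)
  show ?thesis
    using lambda_max_eigenvalue lambda_min_pos eigenvalue_pos
    by (auto simp: kappa_def eigenvalues_def)
qed

lemma kappa_ratio: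
  assumes "v \<in> Omega \<delta>" "u \<in> Omega \<delta>" "max_min_pairs v x y"
  shows "kappa M v * (normalized_square (weight v) x \<bullet> weight u)
    \<le> kappa M u * (normalized_square (weight v) y \<bullet> weight u)"
  using condition_number_ratio[OF weighted_spd_weight[OF assms(1)] weighted_spd_weight[OF assms(2)]]
    assms(3) by (simp add: max_min_pairs_def kappa_def)

text \<open>Both normalised squares have inner product 1 with \<open>weight v\<close>, so the right
  side reduces to the two terms compared in \<open>kappa_ratio\<close>. The positive factor on the
  left stands in for convexity of \<open>kappa\<close>.\<close>

lemma subgrad_inequality:
  assumes v: "v \<in> Omega \<delta>" and u: "u \<in> Omega \<delta>" and xy: "max_min_pairs v x y"
  shows "(normalized_square (weight v) y \<bullet> weight u) * (kappa M v - kappa M u)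
    \<le> subgrad v x y \<bullet> (v - u)"
proof -
  let ?p = "normalized_square (weight v) x" and ?q = "normalized_square (weight v) y"
  have "subgrad v x y \<bullet> (v - u) = kappa M v * ((?p - ?q) \<bullet> (V *v (v - u)))"
    by (simp add: subgrad_eq transpose_matrix_vector dot_lmul_matrix)
  also have "V *v (v - u) = weight v - weight u"
    by (simp add: weight_def matrix_vector_mult_diff_distrib)
  also have "(?p - ?q) \<bullet> (weight v - weight u) = ?q \<bullet> weight u - ?p \<bullet> weight u"
    using max_min_pairs_nonzero[OF xy] inner_normalized_square_self[OF weighted_spd_weight[OF v]]
    by (simp add: inner_diff_left inner_diff_right)
  finally show ?thesis
    using kappa_ratio[OF assms] by (simp add: algebra_simps)
qed

text \<open>Replaces the factor depending on both points by a uniform one, which is valid because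
  the gap is nonnegative.\<close>

lemma kappa_gap_le:
  assumes v: "v \<in> Omega \<delta>" and u: "u \<in> Omega \<delta>" and xy: "max_min_pairs v x y"
    and le: "kappa M u \<le> kappa M v"
  shows "\<delta> / n * (kappa M v - kappa M u) \<le> subgrad v x y \<bullet> (v - u)"
  using subgrad_inequality[OF v u xy] le
    mult_right_mono[OF inner_normalized_square_lower[OF v u max_min_pairs_nonzero(2)[OF xy]],
      of "kappa M v - kappa M u"] by linarith

text \<open>Comparison with the point 0, whose weights are all 1: there the two factors in
  \<open>kappa_ratio\<close> have explicit bounds.\<close>

lemma kappa_bounded:
  assumes v: "v \<in> Omega \<delta>"
  shows "kappa M v \<le> kappa M 0 * n / \<delta>\<^sup>2"
proof -
  obtain x y where xy: "max_min_pairs v x y" using max_min_pairs_exist[OF v] .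
  have z: "0 \<in> Omega \<delta>" using \<delta> by (simp add: zero_in_Omega)
  have w0: "weight (0 :: real ^ 'm) = 1" by (simp add: weight_def)
  have "kappa M v * (\<delta> / n) \<le> kappa M v * (normalized_square (weight v) x \<bullet> weight 0)"
    using inner_normalized_square_lower[OF v z max_min_pairs_nonzero(1)[OF xy]] kappa_pos[OF v]
    by (intro mult_left_mono) auto
  also have "\<dots> \<le> kappa M 0 * (normalized_square (weight v) y \<bullet> weight 0)"
    by (rule kappa_ratio[OF v z xy])
  also have "\<dots> \<le> kappa M 0 * (1 / \<delta>)"
    unfolding w0
    using inner_normalized_square_one_le[OF v max_min_pairs_nonzero(2)[OF xy]] kappa_pos[OF z]
    by (intro mult_left_mono) auto
  finally have *: "kappa M v * (\<delta> / n) \<le> kappa M 0 * (1 / \<delta>)" .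
  with n_pos \<delta> show ?thesis
    by (simp add: field_simps power2_eq_square)
qed

lemma subgrad_bounded:
  obtains G where "0 < G"
    "\<And>v x y. v \<in> Omega \<delta> \<Longrightarrow> max_min_pairs v x y \<Longrightarrow> norm (subgrad v x y) \<le> G"
proof -
  have "bounded_linear ((*v) (transpose V :: real ^ 'm option ^ 'm))"
    by (rule matrix_vector_mul_bounded_linear)
  then obtain B where B: "0 < B"
    "\<And>z. norm ((transpose V :: real ^ 'm option ^ 'm) *v z) \<le> norm z * B"
    using bounded_linear.pos_bounded by blast
  have z: "0 \<in> Omega \<delta>" using \<delta> by (simp add: zero_in_Omega)
  \<comment> \<open>The bound on \<open>kappa\<close>, times 2 / \<delta> for the difference of two
    normalised squares, times the operator bound \<open>B\<close>.\<close>
  let ?G = "kappa M 0 * n / \<delta>\<^sup>2 * (2 / \<delta> * B)"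
  have G: "0 < ?G" using n_pos kappa_pos[OF z] B(1) \<delta> by (intro mult_pos_pos divide_pos_pos) auto
  have "norm (subgrad v x y) \<le> ?G" if v: "v \<in> Omega \<delta>" and xy: "max_min_pairs v x y" for v x y
  proof -
    let ?p = "normalized_square (weight v) x" and ?q = "normalized_square (weight v) y"
    have "norm (?p - ?q) \<le> norm ?p + norm ?q" by (rule norm_triangle_ineq4)
    also have "\<dots> \<le> 2 / \<delta>"
      using norm_normalized_square_le[OF v max_min_pairs_nonzero(1)[OF xy]]
        norm_normalized_square_le[OF v max_min_pairs_nonzero(2)[OF xy]] by simp
    finally have "norm (?p - ?q) * B \<le> 2 / \<delta> * B"
      using B(1) by (intro mult_right_mono) auto
    then have "norm (transpose V *v (?p - ?q)) \<le> 2 / \<delta> * B" using B(2) order_trans by blast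
    then have "kappa M v * norm (transpose V *v (?p - ?q)) \<le> ?G"
      using kappa_bounded[OF v] kappa_pos[OF v] by (intro mult_mono) auto
    then show ?thesis using kappa_pos[OF v] by (simp add: subgrad_eq)
  qed
  then show ?thesis using that G by blast
qed

text \<open>Bounded directions in \<open>kappa_gap_le\<close> make \<open>kappa\<close> Lipschitz
  with constant \<open>G * n /\<close> \<delta>, so continuity needs no eigenvalue perturbation
  theory; compactness does the rest.\<close>

lemma kappa_minimizer:
  obtains u where "u \<in> Omega \<delta>" "\<And>v. v \<in> Omega \<delta> \<Longrightarrow> kappa M u \<le> kappa M v"
proof -
  obtain G where G: "0 < G"
    "\<And>v x y. v \<in> Omega \<delta> \<Longrightarrow> max_min_pairs v x y \<Longrightarrow> norm (subgrad v x y) \<le> G"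
    using subgrad_bounded by blast
  define L where "L = G * n / \<delta>"
  have L: "0 \<le> L" using n_pos G(1) \<delta> unfolding L_def by (intro divide_nonneg_pos mult_nonneg_nonneg) auto
  have lip: "kappa M v - kappa M u \<le> L * dist v u" if v: "v \<in> Omega \<delta>" and u: "u \<in> Omega \<delta>" for u v
  proof (cases "kappa M u \<le> kappa M v")
    case True
    obtain x y where xy: "max_min_pairs v x y" using max_min_pairs_exist[OF v] .
    have "\<delta> / n * (kappa M v - kappa M u) \<le> subgrad v x y \<bullet> (v - u)"
      by (rule kappa_gap_le[OF v u xy True])
    also have "\<dots> \<le> norm (subgrad v x y) * norm (v - u)" by (rule norm_cauchy_schwarz)
    also have "\<dots> \<le> G * dist v u" unfolding dist_norm using G(2)[OF v xy] by (intro mult_right_mono) auto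
    finally show ?thesis using n_pos \<delta> by (simp add: L_def field_simps)
  next
    case False
    then show ?thesis using L mult_nonneg_nonneg[OF L zero_le_dist, of v u] by linarith
  qed
  have "L-lipschitz_on (Omega \<delta>) (kappa M)"
  proof (rule lipschitz_onI)
    fix x y :: "real ^ 'm" assume "x \<in> Omega \<delta>" "y \<in> Omega \<delta>"
    then show "dist (kappa M x) (kappa M y) \<le> L * dist x y"
      using lip[of x y] lip[of y x] by (auto simp: dist_real_def dist_commute abs_le_iff)
  qed (rule L)
  then have "continuous_on (Omega \<delta>) (kappa M)" by (rule lipschitz_on_continuous_on)
  moreover have "Omega \<delta> \<noteq> ({} :: (real ^ 'm) set)"
    using zero_in_Omega[of \<delta>, where 'a = 'm] \<delta> by force
  ultimately show ?thesis
    using that continuous_attains_inf[OF compact_Omega[of \<delta>]] \<delta> by (meson less_imp_le)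
qed

end

section \<open>Projected steps and the convergence rate\<close>

text \<open>Projection is nonexpansive and fixes \<open>u\<close>; the rest is the expanded
  square.\<close>

lemma projected_step_descent:
  fixes S :: "'a::euclidean_space set"
  assumes "convex S" "closed S" "u \<in> S" "norm h = 1"
  shows "(dist (closest_point S (x - t *\<^sub>R h)) u)\<^sup>2 \<le> (dist x u)\<^sup>2 - 2 * t * (h \<bullet> (x - u)) + t\<^sup>2"
proof -
  have "dist (closest_point S (x - t *\<^sub>R h)) (closest_point S u) \<le> dist (x - t *\<^sub>R h) u"
    using assms by (intro closest_point_lipschitz) auto
  then have "(dist (closest_point S (x - t *\<^sub>R h)) u)\<^sup>2 \<le> (dist (x - t *\<^sub>R h) u)\<^sup>2"
    using assms(3) by (simp add: closest_point_self)
  also have "\<dots> = (norm ((x - u) - t *\<^sub>R h))\<^sup>2" by (simp add: dist_norm algebra_simps)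
  also have "\<dots> = (norm (x - u))\<^sup>2 - 2 * t * (h \<bullet> (x - u)) + t\<^sup>2 * (norm h)\<^sup>2"
    unfolding power2_norm_eq_inner
    by (simp add: inner_diff_left inner_diff_right inner_commute power2_eq_square algebra_simps)
  finally show ?thesis using assms(4) by (simp add: dist_norm)
qed

text \<open>
  Summing over all \<open>k \<le> K\<close> would cost a factor \<open>ln K\<close>. Over the second half of the indices
  the sum of the \<open>1 / k\<close> stays bounded, while that of the \<open>1 / sqrt k\<close> keeps its order.
\<close>

lemma inverse_sqrt_step_bound:
  fixes d :: "nat \<Rightarrow> real"
  assumes step: "\<And>k. 1 \<le> k \<Longrightarrow> k \<le> K \<Longrightarrow> d (Suc k) \<le> d k - 2 * a / sqrt (real k) + 1 / real k"
    and d: "\<And>k. 1 \<le> k \<Longrightarrow> 0 \<le> d k" "\<And>k. 1 \<le> k \<Longrightarrow> d k \<le> D" and a: "0 \<le> a" and K: "1 \<le> K"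
  shows "a * sqrt (real K) \<le> D + 2"
proof -
  \<comment> \<open>From \<open>m\<close> to \<open>K\<close> there are at least
    \<open>K / 2\<close> and at most \<open>K\<close> indices, each at least \<open>K / 2\<close>.
    Hence the reciprocals sum to at most 2, the constant in the conclusion.\<close>
  define m where "m = Suc (K div 2)"
  have m: "1 \<le> m" "m \<le> Suc K" "real K / 2 \<le> real (Suc K - m)" "real (Suc K - m) \<le> real K"
    "real K \<le> 2 * real m"
    by (auto simp: m_def)
  have sK: "0 < sqrt (real K)" using K by simp
  have "2 * a / sqrt (real K) * real (Suc K - m) - 2 / real K * real (Suc K - m)
      = (\<Sum>k=m..<Suc K. 2 * a / sqrt (real K) - 2 / real K)"
    by (simp add: algebra_simps)
  also have "\<dots> \<le> (\<Sum>k=m..<Suc K. d k - d (Suc k))"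
  proof (rule sum_mono)
    fix k assume k: "k \<in> {m..<Suc K}"
    then have k': "1 \<le> k" "k \<le> K" "real K \<le> 2 * real k" using m by auto
    have "2 * a / sqrt (real K) \<le> 2 * a / sqrt (real k)"
      using a k' by (intro divide_left_mono) auto
    moreover have "1 / real k \<le> 2 / real K" using k' by (simp add: field_simps)
    ultimately show "2 * a / sqrt (real K) - 2 / real K \<le> d k - d (Suc k)"
      using step[OF k'(1,2)] by linarith
  qed
  also have "\<dots> = d m - d (Suc K)"
    using m(2) sum_Suc_diff'[of m "Suc K" "\<lambda>k. - d k"] by simp
  also have "\<dots> \<le> D" using d(1)[of "Suc K"] d(2)[OF m(1)] by simp
  finally have "2 * a / sqrt (real K) * real (Suc K - m) \<le> D + 2 / real K * real (Suc K - m)"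
    by simp
  also have "2 / real K * real (Suc K - m) \<le> 2"
    using m(4) K by (simp add: field_simps)
  also have "a * sqrt (real K) = 2 * a / sqrt (real K) * (real K / 2)"
    using sK by (simp add: field_simps)
  moreover have "\<dots> \<le> 2 * a / sqrt (real K) * real (Suc K - m)"
    using m(3) a by (intro mult_left_mono) auto
  ultimately show ?thesis by linarith
qed

theorem theorem2p17:
  fixes M :: "real ^ ('m::finite) option ^ ('m::finite) option"
    and \<delta> :: real
    and v g :: "nat \<Rightarrow> real ^ ('m::finite)"
  assumes "symmetric_positive_definite M"
    and "0 < \<delta>" and "\<delta> < 1"
    and "projected_subgradient_run M \<delta> (\<lambda>k. 1 / sqrt (real k)) v g"
    and "\<And>k. 1 \<le> k \<Longrightarrow> g k \<noteq> 0"
  shows "\<exists>vstar \<in> Omega \<delta>. (\<forall>u \<in> Omega \<delta>. kappa M vstar \<le> kappa M u) \<and>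
    (\<exists>C>0. \<forall>\<epsilon>>0. \<forall>K::nat. max 1 (C / \<epsilon>\<^sup>2) \<le> real K \<longrightarrow>
       Min ((\<lambda>k. kappa M (v k)) ` {1..K}) - kappa M vstar \<le> \<epsilon>)"
proof -
  define n where "n = real CARD('m option)"
  interpret kappa_setting M \<delta> n using assms(1-3) n_def by unfold_locales
  obtain u where u: "u \<in> Omega \<delta>" and u_min: "\<And>v. v \<in> Omega \<delta> \<Longrightarrow> kappa M u \<le> kappa M v"
    using kappa_minimizer by blast
  obtain G where G: "0 < G"
    "\<And>v x y. v \<in> Omega \<delta> \<Longrightarrow> max_min_pairs v x y \<Longrightarrow> norm (subgrad v x y) \<le> G"
    using subgrad_bounded by blast
  obtain D where D: "\<And>x. x \<in> Omega \<delta> \<Longrightarrow> dist x u \<le> D"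
    using bounded_Omega[of \<delta>, where 'm = 'm] assms(2) by (metis bounded_any_center dist_commute less_imp_le)
  have D0: "0 \<le> D" using D[OF u] by simp
  have "v 1 = 0" using assms(4) by (simp add: projected_subgradient_run_def)
  have step: "v (Suc k) = closest_point (Omega \<delta>) (v k - (1 / sqrt (real k)) *\<^sub>R (g k /\<^sub>R norm (g k)))"
    if "1 \<le> k" for k
    using assms(4) that by (simp add: projected_subgradient_run_def)
  have grad: "\<exists>x y. max_min_pairs (v k) x y \<and> g k = subgrad (v k) x y" if "1 \<le> k" for k
    using assms(4) that unfolding projected_subgradient_run_def max_min_pairs_def subgrad_def by blast
  have z: "0 \<in> Omega \<delta>" using assms(3) by (simp add: zero_in_Omega)
  \<comment> \<open>The start is feasible as the zero vector, later iterates as projections onto a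
    nonempty closed set; \<open>v 0\<close> is unconstrained.\<close>
  have v: "v k \<in> Omega \<delta>" if "1 \<le> k" for k
  proof (cases "k = 1")
    case True
    then show ?thesis using \<open>v 1 = 0\<close> z by simp
  next
    case False
    with that obtain j where "k = Suc j" "1 \<le> j" by (cases k) auto
    then show ?thesis
      using step[of j] closest_point_in_set[OF closed_Omega[of \<delta>]] z by (metis empty_iff)
  qed
  \<comment> \<open>The factor \<delta> \<open>/ n\<close> of \<open>kappa_gap_le\<close>, divided
    by \<open>G\<close> because the step uses the normalised direction.\<close>
  define c where "c = \<delta> / (n * G)"
  have c: "0 < c" using n_pos assms(2) G(1) unfolding c_def by (intro divide_pos_pos mult_pos_pos)
  have gap: "c * (kappa M (v k) - kappa M u) \<le> (g k /\<^sub>R norm (g k)) \<bullet> (v k - u)" if k: "1 \<le> k" for k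
  proof -
    obtain x y where xy: "max_min_pairs (v k) x y" and g: "g k = subgrad (v k) x y"
      using grad[OF k] by blast
    have gpos: "0 < norm (g k)" "norm (g k) \<le> G" using assms(5)[OF k] G(2)[OF v[OF k] xy] g by auto
    have e: "0 \<le> \<delta> / n * (kappa M (v k) - kappa M u)"
      using u_min[OF v[OF k]] assms(2) n_pos by (intro mult_nonneg_nonneg) auto
    have "c * (kappa M (v k) - kappa M u) = \<delta> / n * (kappa M (v k) - kappa M u) / G"
      by (simp add: c_def)
    also have "\<dots> \<le> \<delta> / n * (kappa M (v k) - kappa M u) / norm (g k)"
      using e gpos G(1) by (intro divide_left_mono) auto
    also have "\<dots> \<le> g k \<bullet> (v k - u) / norm (g k)"
      using kappa_gap_le[OF v[OF k] u xy u_min[OF v[OF k]]] gpos g by (intro divide_right_mono) auto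
    finally show ?thesis by (simp add: divide_inverse mult_ac)
  qed
  \<comment> \<open>Then \<epsilon> \<open>* sqrt K\<close> is at least
    \<open>(D\<^sup>2 + 3) / c\<close>, while a persistent gap above \<epsilon> would force at most
    \<open>(D\<^sup>2 + 2) / c\<close>.\<close>
  define C where "C = ((D\<^sup>2 + 3) / c)\<^sup>2"
  have C: "0 < C" unfolding C_def using c by (simp add: add_nonneg_pos less_imp_neq[symmetric])
  have rate: "Min ((\<lambda>k. kappa M (v k)) ` {1..K}) - kappa M u \<le> \<epsilon>"
    if \<epsilon>: "0 < \<epsilon>" and K: "max 1 (C / \<epsilon>\<^sup>2) \<le> real K" for \<epsilon> :: real and K :: nat
  proof (rule ccontr)
    assume neg: "\<not> ?thesis"
    have K1: "1 \<le> K" using K by simp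
    \<comment> \<open>If the best gap exceeds \<epsilon>, all do, which gives
      \<open>inverse_sqrt_step_bound\<close> a uniform \<open>a = c *\<close> \<epsilon>.\<close>
    have big: "\<epsilon> < kappa M (v k) - kappa M u" if k: "1 \<le> k" "k \<le> K" for k
    proof -
      have "Min ((\<lambda>k. kappa M (v k)) ` {1..K}) \<le> kappa M (v k)"
        using k by (intro Min_le) auto
      then show ?thesis using neg by linarith
    qed
    have "c * \<epsilon> * sqrt (real K) \<le> D\<^sup>2 + 2"
    proof (rule inverse_sqrt_step_bound[where d = "\<lambda>k. (dist (v k) u)\<^sup>2"])
      fix k assume k: "1 \<le> k" "k \<le> K"
      let ?h = "g k /\<^sub>R norm (g k)"
      have "(dist (v (Suc k)) u)\<^sup>2
          \<le> (dist (v k) u)\<^sup>2 - 2 * (1 / sqrt (real k)) * (?h \<bullet> (v k - u)) + (1 / sqrt (real k))\<^sup>2"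
        unfolding step[OF k(1)]
        using assms(5)[OF k(1)] by (intro projected_step_descent convex_Omega closed_Omega u) simp
      moreover have "c * \<epsilon> \<le> ?h \<bullet> (v k - u)"
        using gap[OF k(1)] mult_left_mono[OF less_imp_le[OF big[OF k]], of c] c by linarith
      then have "2 * (1 / sqrt (real k)) * (c * \<epsilon>) \<le> 2 * (1 / sqrt (real k)) * (?h \<bullet> (v k - u))"
        by (intro mult_left_mono) auto
      ultimately show "(dist (v (Suc k)) u)\<^sup>2
          \<le> (dist (v k) u)\<^sup>2 - 2 * (c * \<epsilon>) / sqrt (real k) + 1 / real k"
        using k by (simp add: power_divide)
    next
      fix k :: nat assume "1 \<le> k"
      then show "(dist (v k) u)\<^sup>2 \<le> D\<^sup>2" using D v by (intro power_mono) auto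
    qed (use c \<epsilon> K1 in auto)
    moreover have "(D\<^sup>2 + 3) / c \<le> \<epsilon> * sqrt (real K)"
    proof (rule power2_le_imp_le)
      show "((D\<^sup>2 + 3) / c)\<^sup>2 \<le> (\<epsilon> * sqrt (real K))\<^sup>2"
        unfolding C_def[symmetric] using K \<epsilon> by (simp add: power_mult_distrib field_simps)
    qed (use \<epsilon> in simp)
    ultimately show False using c by (simp add: field_simps)
  qed
  then show ?thesis using u u_min C by blast
qed

end
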